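(* Let $k\ge 3$ and $d_1,\dots,d_k\ge 2$. For every integer $r$ with $2\le r\le\min\{d_1,\dots,d_k\}$, the problem of determining a best rank-$r$ approximation for an order-$k$ tensor in $\mathbb{R}^{d_1\times\dots\times d_k}$ has no solution in general. In particular, there exists $A\in\mathbb{R}^{d_1\times\dots\times d_k}$ with $\operatorname{rank}_{\otimes}(A)=r+1$ that has no best rank-$r$ approximation, regardless of the choice of norm: for every norm $\|\cdot\|$ on $\mathbb{R}^{d_1\times\dots\times d_k}$, the infimum $\inf\{\|A-B\| : \operatorname{rank}_{\otimes}(B)\le r\}$ is not attained by any $B$ with $\operatorname{rank}_{\otimes}(B)\le r$.
   Context: $\mathbb{R}^{d_1\times\dots\times d_k}\cong\mathbb{R}^{d_1}\otimes\dots\otimes\mathbb{R}^{d_k}$ is the space of real $k$-way arrays; $\mathbf{x}_1\otimes\dots\otimes\mathbf{x}_k$ is the array with entries $x^{(1)}_{j_1}\cdots x^{(k)}_{j_k}$, and such arrays are called decomposable. The outer-product rank $\operatorname{rank}_{\otimes}(A)$ is the least $r\ge 0$ such that $A$ is a sum of $r$ decomposable tensors. A best rank-$r$ approximation of $A$ (with respect to a norm) is a tensor $B$ with $\operatorname{rank}_{\otimes}(B)\le r$ attaining $\inf\{\|A-B'\| : \operatorname{rank}_{\otimes}(B')\le r\}$. *)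

theory Defs
  imports Complex_Main "HOL-Library.FuncSet"
begin

text \<open>The modes are numbered \<open>0, \<dots>, k - 1\<close>, and mode \<open>i\<close> has coordinates \<open>0, \<dots>, d i - 1\<close>.\<close>

definition tensor_index :: "nat \<Rightarrow> (nat \<Rightarrow> nat) \<Rightarrow> (nat \<Rightarrow> nat) set" where
  "tensor_index k d = (\<Pi>\<^sub>E i\<in>{..<k}. {..<d i})"

text \<open>A \<open>k\<close>-way array is represented by its extension by zero to all functions
  \<open>nat \<Rightarrow> nat\<close>, so that equality of arrays is equality of functions.\<close>

type_synonym tensor = "(nat \<Rightarrow> nat) \<Rightarrow> real"

definition tensor_space :: "nat \<Rightarrow> (nat \<Rightarrow> nat) \<Rightarrow> tensor set" where
  "tensor_space k d = {A. \<forall>j. j \<notin> tensor_index k d \<longrightarrow> A j = 0}"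

text \<open>The vector in mode \<open>i\<close> is \<open>x i\<close>; only its coordinates below \<open>d i\<close> matter.\<close>

definition outer_product :: "nat \<Rightarrow> (nat \<Rightarrow> nat) \<Rightarrow> (nat \<Rightarrow> nat \<Rightarrow> real) \<Rightarrow> tensor" where
  "outer_product k d x = (\<lambda>j. if j \<in> tensor_index k d then (\<Prod>i<k. x i (j i)) else 0)"

definition decomposable :: "nat \<Rightarrow> (nat \<Rightarrow> nat) \<Rightarrow> tensor \<Rightarrow> bool" where
  "decomposable k d A \<longleftrightarrow> (\<exists>x. A = outer_product k d x)"

definition sum_of_decomposables :: "nat \<Rightarrow> (nat \<Rightarrow> nat) \<Rightarrow> nat \<Rightarrow> tensor \<Rightarrow> bool" where
  "sum_of_decomposables k d r A \<longleftrightarrow>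
     (\<exists>T. (\<forall>p<r. decomposable k d (T p)) \<and> A = (\<lambda>j. \<Sum>p<r. T p j))"

text \<open>Meaningful on \<open>tensor_space k d\<close> with \<open>k \<ge> 1\<close> only, where such an \<open>r\<close> exists
  (\<open>ex_sum_of_decomposables\<close> below).\<close>

definition tensor_rank :: "nat \<Rightarrow> (nat \<Rightarrow> nat) \<Rightarrow> tensor \<Rightarrow> nat" where
  "tensor_rank k d A = (LEAST r. sum_of_decomposables k d r A)"

text \<open>Norms on the space of arrays; the values of \<open>N\<close> outside that space are irrelevant.\<close>

definition tensor_norm :: "nat \<Rightarrow> (nat \<Rightarrow> nat) \<Rightarrow> (tensor \<Rightarrow> real) \<Rightarrow> bool" where
  "tensor_norm k d N \<longleftrightarrow>
     (\<forall>A\<in>tensor_space k d. 0 \<le> N A \<and> (N A = 0 \<longleftrightarrow> A = (\<lambda>j. 0))) \<and>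
     (\<forall>A\<in>tensor_space k d. \<forall>c. N (\<lambda>j. c * A j) = \<bar>c\<bar> * N A) \<and>
     (\<forall>A\<in>tensor_space k d. \<forall>B\<in>tensor_space k d. N (\<lambda>j. A j + B j) \<le> N A + N B)"

definition tensors_of_rank_le :: "nat \<Rightarrow> (nat \<Rightarrow> nat) \<Rightarrow> nat \<Rightarrow> tensor set" where
  "tensors_of_rank_le k d r = {B \<in> tensor_space k d. tensor_rank k d B \<le> r}"

definition best_rank_approximation ::
    "nat \<Rightarrow> (nat \<Rightarrow> nat) \<Rightarrow> (tensor \<Rightarrow> real) \<Rightarrow> nat \<Rightarrow> tensor \<Rightarrow> tensor \<Rightarrow> bool" where
  "best_rank_approximation k d N r A B \<longleftrightarrow>
     B \<in> tensors_of_rank_le k d r \<and>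
     N (\<lambda>j. A j - B j) = (INF B'\<in>tensors_of_rank_le k d r. N (\<lambda>j. A j - B' j))"

lemma finite_tensor_index: "finite (tensor_index k d)"
  by (simp add: tensor_index_def finite_PiE)

lemma ex_sum_of_decomposables:
  assumes "k \<ge> 1" and A: "A \<in> tensor_space k d"
  shows "\<exists>r. sum_of_decomposables k d r A"
proof -
  let ?I = "tensor_index k d"
  obtain h where h: "bij_betw h {..<card ?I} ?I"
    using ex_bij_betw_nat_finite[OF finite_tensor_index] by (auto simp: atLeast0LessThan)
  define x :: "nat \<Rightarrow> nat \<Rightarrow> nat \<Rightarrow> real" where
    "x p i n = (if i = 0 then A (h p) else 1) * (if n = h p i then 1 else 0)" for p i n
  have eq: "outer_product k d (x p) j = (if j = h p then A (h p) else 0)"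
    if p: "p < card ?I" for p j
  proof (cases "j \<in> ?I")
    case True
    have hp: "h p \<in> ?I" using h p by (auto simp: bij_betw_def)
    have j_eq: "j = h p \<longleftrightarrow> (\<forall>i<k. j i = h p i)"
      using PiE_ext[OF True[unfolded tensor_index_def] hp[unfolded tensor_index_def]] by auto
    have "(\<Prod>i<k. if i = 0 then A (h p) else 1) = A (h p)"
      using \<open>k \<ge> 1\<close> by (subst prod.delta) auto
    moreover have "(\<Prod>i<k. if j i = h p i then 1 else 0 :: real) = (if j = h p then 1 else 0)"
      using j_eq by (cases "j = h p") (auto intro!: prod.neutral simp: prod_zero_iff)
    ultimately show ?thesis
      using True by (simp add: outer_product_def x_def prod.distrib)
  next
    case False
    then show ?thesis using h p by (auto simp: outer_product_def bij_betw_def)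
  qed
  have "A = (\<lambda>j. \<Sum>p<card ?I. outer_product k d (x p) j)"
  proof
    fix j
    have "(\<Sum>p<card ?I. outer_product k d (x p) j)
        = (\<Sum>p<card ?I. if j = h p then A (h p) else 0)"
      by (rule sum.cong) (auto simp: eq)
    also have "\<dots> = (\<Sum>m\<in>?I. if j = m then A m else 0)"
      by (rule sum.reindex_bij_betw[OF h])
    also have "\<dots> = A j"
      using A by (subst sum.delta') (auto simp: finite_tensor_index tensor_space_def)
    finally show "A j = (\<Sum>p<card ?I. outer_product k d (x p) j)" by simp
  qed
  then have "sum_of_decomposables k d (card ?I) A"
    unfolding sum_of_decomposables_def decomposable_def
    by (intro exI[of _ "\<lambda>p. outer_product k d (x p)"] conjI allI impI) auto
  then show ?thesis ..
qed

end

theory Submission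
  imports Defs "Jordan_Normal_Form.Determinant"
begin

text \<open>
  With \<open>e\<^sub>p\<close> the unit vectors, let \<open>W = e\<^sub>0 \<otimes> e\<^sub>0 \<otimes> e\<^sub>1 + e\<^sub>0 \<otimes> e\<^sub>1 \<otimes> e\<^sub>0 + e\<^sub>1 \<otimes> e\<^sub>0 \<otimes> e\<^sub>0\<close> and let \<open>A\<close>
  be \<open>W + (\<Sum>2 \<le> p < r. e\<^sub>p \<otimes> e\<^sub>p \<otimes> e\<^sub>p)\<close>, multiplied by \<open>e\<^sub>0\<close> in all further modes. As \<open>h\<close> tends to
  \<open>0\<close>, the rank-two tensors \<open>h\<^sup>-\<^sup>1 ((e\<^sub>0 + h e\<^sub>1) \<otimes> (e\<^sub>0 + h e\<^sub>1) \<otimes> (e\<^sub>0 + h e\<^sub>1) - e\<^sub>0 \<otimes> e\<^sub>0 \<otimes> e\<^sub>0)\<close> tend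
  to \<open>W\<close>, so the distance from \<open>A\<close> to the tensors of rank at most \<open>r\<close> is \<open>0\<close> in every norm. It is not
  attained, because \<open>A\<close> has rank \<open>r + 1\<close>: if \<open>A\<close> were a sum of \<open>r\<close> decomposable tensors, then its
  third-mode slices would be \<open>U D\<^sub>c V\<close> with square \<open>U, V\<close> and diagonal \<open>D\<^sub>c\<close>. Some combination \<open>S\<close> of
  the slices is a permutation matrix, hence \<open>U\<close> diagonalises \<open>S\<^sub>1 S\<^sup>-\<^sup>1\<close> for the slice \<open>S\<^sub>1\<close>, but
  this matrix is nilpotent and nonzero.
\<close>

section \<open>Sums of decomposable tensors and rank\<close>

lemma sum_of_decomposables_in_tensor_space:
  assumes "sum_of_decomposables k d n A"
  shows "A \<in> tensor_space k d"
proof -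
  obtain T where T: "\<And>p. p < n \<Longrightarrow> decomposable k d (T p)" and A: "A = (\<lambda>j. \<Sum>p<n. T p j)"
    using assms by (auto simp: sum_of_decomposables_def)
  have "T p j = 0" if "p < n" "j \<notin> tensor_index k d" for p j
    using T[OF that(1)] that(2) by (auto simp: decomposable_def outer_product_def)
  then show ?thesis by (simp add: A tensor_space_def)
qed

lemma sum_of_decomposables_outer_product: "sum_of_decomposables k d 1 (outer_product k d x)"
  unfolding sum_of_decomposables_def decomposable_def
  by (intro exI[of _ "\<lambda>_. outer_product k d x"]) auto

lemma sum_of_decomposables_add:
  assumes "sum_of_decomposables k d m A" "sum_of_decomposables k d n B"
  shows "sum_of_decomposables k d (m + n) (\<lambda>j. A j + B j)"
proof -
  obtain S where S: "\<forall>p<m. decomposable k d (S p)" "A = (\<lambda>j. \<Sum>p<m. S p j)"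
    using assms(1) by (auto simp: sum_of_decomposables_def)
  obtain T where T: "\<forall>p<n. decomposable k d (T p)" "B = (\<lambda>j. \<Sum>p<n. T p j)"
    using assms(2) by (auto simp: sum_of_decomposables_def)
  define R where "R p = (if p < m then S p else T (p - m))" for p
  have "(\<Sum>p<m + n. R p j) = (\<Sum>p<m. S p j) + (\<Sum>p<n. T p j)" for j
    by (induction n) (auto simp: R_def)
  then show ?thesis
    unfolding sum_of_decomposables_def using S T by (intro exI[of _ R]) (auto simp: R_def)
qed

lemma sum_of_decomposables_mono:
  assumes "k \<ge> 1" "m \<le> n" "sum_of_decomposables k d m A"
  shows "sum_of_decomposables k d n A"
proof -
  \<comment> \<open>The zero tensor needs a mode to hold a zero factor: for \<open>k = 0\<close> the
    empty product is 1.\<close>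
  have "decomposable k d (\<lambda>_. 0)"
    unfolding decomposable_def using \<open>k \<ge> 1\<close>
    by (intro exI[of _ "\<lambda>_ _. 0"]) (auto simp: outer_product_def fun_eq_iff)
  then have "sum_of_decomposables k d (n - m) (\<lambda>_. 0)"
    unfolding sum_of_decomposables_def by (intro exI[of _ "\<lambda>_ _. 0"]) auto
  from sum_of_decomposables_add[OF assms(3) this] show ?thesis
    using \<open>m \<le> n\<close> by simp
qed

lemma tensor_rank_eq_SucI:
  assumes "k \<ge> 1" "sum_of_decomposables k d (Suc r) A" "\<not> sum_of_decomposables k d r A"
  shows "tensor_rank k d A = Suc r"
  unfolding tensor_rank_def
proof (rule Least_equality)
  show "Suc r \<le> s" if "sum_of_decomposables k d s A" for s
    using that assms sum_of_decomposables_mono[of k s r d A] by (meson not_less_eq_eq)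
qed (fact assms)

text \<open>Since the infimum is 0, a minimiser would lie at distance 0 from \<open>A\<close>, hence
  equal \<open>A\<close> by definiteness of the norm, and \<open>A\<close> has too large a
  rank.\<close>

lemma not_best_rank_approximation:
  assumes N: "tensor_norm k d N" and A: "A \<in> tensor_space k d" "tensor_rank k d A > r"
    and approx: "\<And>e. e > 0 \<Longrightarrow> \<exists>B\<in>tensors_of_rank_le k d r. N (\<lambda>j. A j - B j) < e"
  shows "\<not> best_rank_approximation k d N r A B"
proof
  assume "best_rank_approximation k d N r A B"
  then have B: "B \<in> tensors_of_rank_le k d r"
    and inf: "N (\<lambda>j. A j - B j) = (INF B'\<in>tensors_of_rank_le k d r. N (\<lambda>j. A j - B' j))"
    by (auto simp: best_rank_approximation_def)
  have diff: "(\<lambda>j. A j - B' j) \<in> tensor_space k d" if "B' \<in> tensors_of_rank_le k d r" for B'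
    using that A by (simp add: tensor_space_def tensors_of_rank_le_def)
  have nonneg: "0 \<le> N (\<lambda>j. A j - B' j)" if "B' \<in> tensors_of_rank_le k d r" for B'
    using diff[OF that] N by (simp add: tensor_norm_def)
  have "N (\<lambda>j. A j - B j) \<le> N (\<lambda>j. A j - B' j)" if "B' \<in> tensors_of_rank_le k d r" for B'
    unfolding inf by (rule cINF_lower[OF _ that]) (use nonneg in \<open>auto intro!: bdd_belowI2\<close>)
  with approx have "\<not> N (\<lambda>j. A j - B j) > 0"
    by (meson not_less)
  with nonneg[OF B] have "N (\<lambda>j. A j - B j) = 0" by simp
  with diff[OF B] N have "(\<lambda>j. A j - B j) = (\<lambda>j. 0)"
    by (simp add: tensor_norm_def)
  then have "A = B" by (simp add: fun_eq_iff)
  with B A(2) show False by (simp add: tensors_of_rank_le_def)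
qed

section \<open>The tensor and its three-mode core\<close>

definition basis_vec :: "nat \<Rightarrow> nat \<Rightarrow> real" where
  "basis_vec p n = of_bool (n = p)"

definition outer3 ::
    "nat \<Rightarrow> (nat \<Rightarrow> nat) \<Rightarrow> (nat \<Rightarrow> real) \<Rightarrow> (nat \<Rightarrow> real) \<Rightarrow> (nat \<Rightarrow> real) \<Rightarrow> tensor" where
  "outer3 k d x y z =
     outer_product k d (\<lambda>i. if i = 0 then x else if i = 1 then y else if i = 2 then z else basis_vec 0)"

text \<open>The factor common to all values of \<open>outer3\<close>. Once it is split off, tensor
  identities become identities in the first three indices.\<close>

definition mode_tail :: "nat \<Rightarrow> (nat \<Rightarrow> nat) \<Rightarrow> tensor" where
  "mode_tail k d j = of_bool (j \<in> tensor_index k d) * (\<Prod>i<k - 3. basis_vec 0 (j (i + 3)))"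

lemma prod_lessThan_split3:
  fixes f :: "nat \<Rightarrow> 'a::comm_monoid_mult"
  assumes "k \<ge> 3"
  shows "(\<Prod>i<k. f i) = f 0 * f 1 * f 2 * (\<Prod>i<k - 3. f (i + 3))"
proof -
  obtain l where "k = Suc (Suc (Suc l))"
    using assms by (metis Suc_le_D numeral_3_eq_3 Suc_le_mono)
  then show ?thesis
    by (simp add: prod.lessThan_Suc_shift numeral_2_eq_2 numeral_3_eq_3 mult.assoc del: prod.lessThan_Suc)
qed

lemma outer3_apply:
  assumes "k \<ge> 3"
  shows "outer3 k d x y z j = x (j 0) * y (j 1) * z (j 2) * mode_tail k d j"
  by (simp add: outer3_def outer_product_def mode_tail_def prod_lessThan_split3[OF assms])

definition core :: "nat \<Rightarrow> nat \<Rightarrow> nat \<Rightarrow> nat \<Rightarrow> real" where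
  "core m a b c =
     basis_vec 0 a * basis_vec 0 b * basis_vec 1 c + basis_vec 0 a * basis_vec 1 b * basis_vec 0 c +
     basis_vec 1 a * basis_vec 0 b * basis_vec 0 c +
     (\<Sum>p<m. basis_vec (p + 2) a * basis_vec (p + 2) b * basis_vec (p + 2) c)"

definition core_tensor :: "nat \<Rightarrow> (nat \<Rightarrow> nat) \<Rightarrow> nat \<Rightarrow> tensor" where
  "core_tensor k d m j = core m (j 0) (j 1) (j 2) * mode_tail k d j"

section \<open>Lower bound on the rank\<close>

lemma left_inverse_imp_right_inverse:
  fixes X Y :: "nat \<Rightarrow> nat \<Rightarrow> 'a::field"
  assumes XY: "\<And>a b. a < n \<Longrightarrow> b < n \<Longrightarrow> (\<Sum>p<n. X a p * Y p b) = of_bool (a = b)"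
    and "p < n" "q < n"
  shows "(\<Sum>a<n. Y p a * X a q) = of_bool (p = q)"
proof -
  let ?X = "mat n n (\<lambda>(a, p). X a p)" and ?Y = "mat n n (\<lambda>(p, a). Y p a)"
  have "?X * ?Y = 1\<^sub>m n"
    by (rule eq_matI) (auto simp: scalar_prod_def XY atLeast0LessThan)
  then have "?Y * ?X = 1\<^sub>m n"
    by (rule mat_mult_left_right_inverse[rotated 2]) auto
  then have "(?Y * ?X) $$ (p, q) = 1\<^sub>m n $$ (p, q)" by simp
  then show ?thesis
    using \<open>p < n\<close> \<open>q < n\<close> by (auto simp: scalar_prod_def atLeast0LessThan)
qed

text \<open>Slice 0 exchanges the first two unit vectors and slice \<open>q + 2\<close> is a
  diagonal matrix unit. So all slices but slice 1 add up to a transposition matrix, which the column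
  swap turns into the identity.\<close>

lemma core_slice_sum:
  assumes "a < m + 2" "b < m + 2"
  shows "core m a (transpose 0 1 b) 0 + (\<Sum>q<m. core m a (transpose 0 1 b) (q + 2)) = of_bool (a = b)"
proof -
  have slice0: "core m a b' 0 = of_bool (a = 0 \<and> b' = 1 \<or> a = 1 \<and> b' = 0)" for b'
    by (auto simp: core_def basis_vec_def)
  have slice: "core m a b' (q + 2) = of_bool (a = q + 2 \<and> b' = q + 2)" if "q < m" for b' q
  proof -
    have "core m a b' (q + 2) = (\<Sum>p<m. if p = q then of_bool (a = q + 2 \<and> b' = q + 2) else 0)"
      unfolding core_def basis_vec_def
      by (simp only: of_bool_eq add_2_eq_Suc' nat.distinct One_nat_def nat.inject mult_zero_right add_0_left)
        (rule sum.cong, auto)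
    with that show ?thesis by simp
  qed
  \<comment> \<open>For \<open>a < 2\<close> the truncated \<open>a - 2\<close> is 0, hence the
    guard \<open>a \<ge> 2\<close> inside the summand.\<close>
  have "(\<Sum>q<m. core m a b' (q + 2)) = (\<Sum>q<m. if q = a - 2 then of_bool (a \<ge> 2 \<and> b' = a) else 0)" for b'
    by (rule sum.cong) (auto simp: slice simp del: add_2_eq_Suc')
  also have "\<dots> b' = of_bool (a \<ge> 2 \<and> b' = a)" for b'
    using assms by auto
  finally show ?thesis
    by (auto simp: slice0 transpose_def)
qed

lemma core_slice_1: "core m a (transpose 0 1 b) 1 = of_bool (a = 0 \<and> b = 1)"
  by (auto simp: core_def basis_vec_def transpose_def)

lemma core_not_sum:
  fixes u v w :: "nat \<Rightarrow> nat \<Rightarrow> real"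
  assumes uvw: "\<And>a b c. a < m + 2 \<Longrightarrow> b < m + 2 \<Longrightarrow> c < m + 2 \<Longrightarrow>
      (\<Sum>p<m + 2. u p a * v p b * w p c) = core m a b c"
  shows False
proof -
  define n where "n = m + 2"
  have n: "0 < n" "1 < n" by (auto simp: n_def)
  note uvw = uvw[folded n_def]
  define \<sigma> :: "nat \<Rightarrow> nat" where "\<sigma> = transpose 0 1"
  have \<sigma>: "\<sigma> b < n" if "b < n" for b
    using that n by (auto simp: \<sigma>_def transpose_def simp del: One_nat_def)
  \<comment> \<open>\<open>s\<close> is the diagonal factor of the sum of all slices but slice 1.
    With it and the column swap absorbed into \<open>y\<close>, \<open>core_slice_sum\<close> says
    that \<open>y\<close> inverts the transpose of \<open>u\<close>.\<close>
  define s where "s p = w p 0 + (\<Sum>q<m. w p (q + 2))" for p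
  define y where "y p b = s p * v p (\<sigma> b)" for p b
  have uy: "(\<Sum>p<n. u p a * y p b) = of_bool (a = b)" if "a < n" "b < n" for a b
  proof -
    have "(\<Sum>p<n. u p a * y p b)
        = (\<Sum>p<n. u p a * v p (\<sigma> b) * w p 0) + (\<Sum>q<m. \<Sum>p<n. u p a * v p (\<sigma> b) * w p (q + 2))"
      unfolding y_def s_def
      by (subst sum.swap, subst sum.distrib[symmetric])
         (simp add: algebra_simps sum_distrib_left)
    also have "\<dots> = core m a (\<sigma> b) 0 + (\<Sum>q<m. core m a (\<sigma> b) (q + 2))"
      using that \<sigma> n by (intro arg_cong2[of _ _ _ _ "(+)"] sum.cong uvw) (auto simp: n_def)
    finally show ?thesis
      using core_slice_sum[where m = m, folded n_def, OF that] by (simp add: \<sigma>_def)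
  qed
  \<comment> \<open>There are as many summands as indices, so the matrices are square and the
    one-sided inverse is two-sided.\<close>
  have yu: "(\<Sum>a<n. y p a * u q a) = of_bool (p = q)" if "p < n" "q < n" for p q
    by (rule left_inverse_imp_right_inverse[where X = "\<lambda>a p. u p a"]) (use uy that in auto)
  have slice1: "(\<Sum>p<n. u p a * v p (\<sigma> b) * w p 1) = of_bool (a = 0 \<and> b = 1)" if "a < n" "b < n" for a b
    using uvw[of a "\<sigma> b" 1] core_slice_1[of m a b] that n \<sigma> by (simp add: \<sigma>_def)
  txt \<open>Conjugating the elementary matrix \<open>E\<^sub>0\<^sub>1\<close> by \<open>u\<close> gives a diagonal matrix.\<close>
  have key: "s p * (y p 0 * u q 1) = w p 1 * of_bool (p = q)" if "p < n" "q < n" for p q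
  proof -
    have inner: "(\<Sum>b<n. y p a * of_bool (a = 0 \<and> b = 1) * u q b) = (if a = 0 then y p 0 * u q 1 else 0)" for a
    proof -
      have "(\<Sum>b<n. y p a * of_bool (a = 0 \<and> b = 1) * u q b)
          = (\<Sum>b<n. if b = 1 then if a = 0 then y p 0 * u q 1 else 0 else 0)"
        by (rule sum.cong) auto
      then show ?thesis using n by simp
    qed
    have "y p 0 * u q 1 = (\<Sum>a<n. \<Sum>b<n. y p a * of_bool (a = 0 \<and> b = 1) * u q b)"
      unfolding inner using n by simp
    also have "\<dots> = (\<Sum>a<n. \<Sum>b<n. \<Sum>l<n. y p a * (u l a * v l (\<sigma> b) * w l 1) * u q b)"
      by (intro sum.cong refl, subst slice1[symmetric]) (auto simp: sum_distrib_left sum_distrib_right)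
    also have "\<dots> = (\<Sum>a<n. \<Sum>l<n. \<Sum>b<n. y p a * (u l a * v l (\<sigma> b) * w l 1) * u q b)"
      by (intro sum.cong refl sum.swap)
    also have "\<dots> = (\<Sum>l<n. \<Sum>a<n. \<Sum>b<n. y p a * (u l a * v l (\<sigma> b) * w l 1) * u q b)"
      by (rule sum.swap)
    also have "\<dots> = (\<Sum>l<n. (\<Sum>a<n. y p a * u l a) * (\<Sum>b<n. w l 1 * (v l (\<sigma> b) * u q b)))"
      by (simp only: sum_product ac_simps)
    also have "\<dots> = (\<Sum>l<n. if l = p then \<Sum>b<n. w l 1 * (v l (\<sigma> b) * u q b) else 0)"
      using that by (intro sum.cong refl) (simp add: yu)
    also have "\<dots> = (\<Sum>b<n. w p 1 * (v p (\<sigma> b) * u q b))"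
      using that by simp
    \<comment> \<open>Multiplying by \<open>s p\<close> turns \<open>v p (\<sigma> b)\<close> into
      \<open>y p b\<close>, which avoids a division.\<close>
    finally have "s p * (y p 0 * u q 1) = s p * (\<Sum>b<n. w p 1 * (v p (\<sigma> b) * u q b))"
      by simp
    also have "\<dots> = w p 1 * (\<Sum>b<n. y p b * u q b)"
      by (simp only: y_def sum_distrib_left ac_simps)
    finally have "s p * (y p 0 * u q 1) = w p 1 * (\<Sum>b<n. y p b * u q b)" .
    then show ?thesis using yu[OF that] by simp
  qed
  \<comment> \<open>This entry of the swapped slice 1 is 1, so some diagonal entry
    \<open>w p 1\<close> is nonzero. Then \<open>key\<close> makes \<open>s p\<close>,
    \<open>y p 0\<close> and \<open>u p 1\<close> nonzero and, off the diagonal, forces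
    \<open>u q 1 = 0\<close>.\<close>
  have "(\<Sum>p<n. u p 0 * v p (\<sigma> 1) * w p 1) \<noteq> 0"
    using n by (subst slice1) auto
  then obtain p where p: "p < n" "w p 1 \<noteq> 0"
    by (metis (no_types, lifting) lessThan_iff mult_eq_0_iff sum.neutral)
  with key[of p p] have nonzero: "y p 0 \<noteq> 0" "u p 1 \<noteq> 0" by auto
  have zero: "u q 1 = 0" if "q < n" "q \<noteq> p" for q
    using key[OF p(1) that(1)] key[OF p(1) p(1)] that nonzero p by auto
  \<comment> \<open>The off-diagonal entry (1, 0) of the identity \<open>uy\<close> reduces to the
    single nonzero term at \<open>p\<close>.\<close>
  have "0 = (\<Sum>q<n. u q 1 * y q 0)"
    using n by (subst uy) auto
  also have "\<dots> = (\<Sum>q<n. if q = p then u p 1 * y p 0 else 0)"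
    by (intro sum.cong) (auto simp: zero simp del: One_nat_def)
  also have "\<dots> = u p 1 * y p 0"
    using p by simp
  finally show False using nonzero by simp
qed

text \<open>Restricting the first three indices to values below \<open>m + 2\<close> and setting all
  others to 0 reduces this to \<open>core_not_sum\<close>. The factors of the later modes become
  constants, absorbed into the third vector.\<close>

lemma core_tensor_not_sum_of_decomposables:
  assumes "k \<ge> 3" and d: "\<And>i. i < k \<Longrightarrow> m + 2 \<le> d i"
  shows "\<not> sum_of_decomposables k d (m + 2) (core_tensor k d m)"
proof
  assume "sum_of_decomposables k d (m + 2) (core_tensor k d m)"
  then obtain T where T: "\<And>p. p < m + 2 \<Longrightarrow> \<exists>x. T p = outer_product k d x"
    and eq: "core_tensor k d m = (\<lambda>j. \<Sum>p<m + 2. T p j)"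
    by (auto simp: sum_of_decomposables_def decomposable_def)
  then obtain x where x: "\<And>p. p < m + 2 \<Longrightarrow> T p = outer_product k d (x p)"
    by metis
  show False
  proof (rule core_not_sum)
    fix a b c :: nat
    assume abc: "a < m + 2" "b < m + 2" "c < m + 2"
    define j where
      "j = (\<lambda>i\<in>{..<k}. if i = 0 then a else if i = 1 then b else if i = 2 then c else 0)"
    have j: "j \<in> tensor_index k d"
      using abc d by (fastforce simp: j_def tensor_index_def)
    have j012: "j 0 = a" "j 1 = b" "j 2 = c" and j0: "\<And>i. i < k - 3 \<Longrightarrow> j (i + 3) = 0"
      using \<open>k \<ge> 3\<close> by (auto simp: j_def)
    have "core m a b c = core_tensor k d m j"
      using j j012 j0 by (simp add: core_tensor_def mode_tail_def basis_vec_def)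
    also have "\<dots> = (\<Sum>p<m + 2. outer_product k d (x p) j)"
      unfolding eq using x by simp
    also have "\<dots> = (\<Sum>p<m + 2. x p 0 a * x p 1 b * (x p 2 c * (\<Prod>i<k - 3. x p (i + 3) 0)))"
      using j j012 j0
      by (simp add: outer_product_def prod_lessThan_split3[OF \<open>k \<ge> 3\<close>] mult.assoc)
    finally show "(\<Sum>p<m + 2. x p 0 a * x p 1 b * (x p 2 c * (\<Prod>i<k - 3. x p (i + 3) 0))) = core m a b c"
      by simp
  qed
qed

section \<open>Upper bound on the rank and approximation\<close>

lemma sum_of_decomposables_outer3: "sum_of_decomposables k d 1 (outer3 k d x y z)"
  unfolding outer3_def by (rule sum_of_decomposables_outer_product)

lemma sum_of_decomposables_diagonal:
  "sum_of_decomposables k d m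
     (\<lambda>j. \<Sum>p<m. outer3 k d (basis_vec (p + 2)) (basis_vec (p + 2)) (basis_vec (p + 2)) j)"
  unfolding sum_of_decomposables_def
  by (rule exI[of _ "\<lambda>p. outer3 k d (basis_vec (p + 2)) (basis_vec (p + 2)) (basis_vec (p + 2))"])
    (auto simp: decomposable_def outer3_def)

lemma core_tensor_eq_sum:
  assumes "k \<ge> 3"
  shows "core_tensor k d m = (\<lambda>j.
    outer3 k d (basis_vec 0) (basis_vec 0) (basis_vec 1) j + outer3 k d (basis_vec 0) (basis_vec 1) (basis_vec 0) j +
    outer3 k d (basis_vec 1) (basis_vec 0) (basis_vec 0) j +
    (\<Sum>p<m. outer3 k d (basis_vec (p + 2)) (basis_vec (p + 2)) (basis_vec (p + 2)) j))"
  by (simp add: fun_eq_iff core_tensor_def core_def outer3_apply[OF assms] distrib_right sum_distrib_right)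

lemma sum_of_decomposables_core_tensor:
  assumes "k \<ge> 3"
  shows "sum_of_decomposables k d (m + 3) (core_tensor k d m)"
proof -
  have "sum_of_decomposables k d (1 + 1 + 1 + m) (core_tensor k d m)"
    unfolding core_tensor_eq_sum[OF assms]
    by (intro sum_of_decomposables_add sum_of_decomposables_outer3 sum_of_decomposables_diagonal)
  then show ?thesis by (simp add: numeral_3_eq_3)
qed

text \<open>The first two terms are the difference quotient of the tensor cube of
  \<open>e0 + h e1\<close> at \<open>h = 0\<close>. The scalars \<open>1 / h\<close> and
  \<open>- 1 / h\<close> sit in the first mode, which keeps each term decomposable.\<close>

definition core_approx :: "nat \<Rightarrow> (nat \<Rightarrow> nat) \<Rightarrow> nat \<Rightarrow> real \<Rightarrow> tensor" where
  "core_approx k d m h = (\<lambda>j.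
     outer3 k d (\<lambda>n. (basis_vec 0 n + h * basis_vec 1 n) / h)
       (\<lambda>n. basis_vec 0 n + h * basis_vec 1 n) (\<lambda>n. basis_vec 0 n + h * basis_vec 1 n) j +
     outer3 k d (\<lambda>n. - (basis_vec 0 n / h)) (basis_vec 0) (basis_vec 0) j +
     (\<Sum>p<m. outer3 k d (basis_vec (p + 2)) (basis_vec (p + 2)) (basis_vec (p + 2)) j))"

lemma core_approx_rank_le: "core_approx k d m h \<in> tensors_of_rank_le k d (m + 2)"
proof -
  have "sum_of_decomposables k d (1 + 1 + m) (core_approx k d m h)"
    unfolding core_approx_def
    by (intro sum_of_decomposables_add sum_of_decomposables_outer3 sum_of_decomposables_diagonal)
  then have "sum_of_decomposables k d (m + 2) (core_approx k d m h)" by simp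
  then show ?thesis
    by (auto simp: tensors_of_rank_le_def tensor_rank_def intro: Least_le
        sum_of_decomposables_in_tensor_space)
qed

lemma core_tensor_approximable:
  assumes "k \<ge> 3" and N: "tensor_norm k d N" and "e > 0"
  shows "\<exists>B\<in>tensors_of_rank_le k d (m + 2). N (\<lambda>j. core_tensor k d m j - B j) < e"
proof -
  \<comment> \<open>\<open>C\<close> and \<open>D\<close> are the coefficients of \<open>h\<close>
    and \<open>h\<^sup>2\<close> in \<open>core_approx\<close>. Only the norms of these two fixed
    tensors enter the estimate, so it works for every norm.\<close>
  define C where "C j =
     (basis_vec 0 (j 0) * basis_vec 1 (j 1) * basis_vec 1 (j 2) +
      basis_vec 1 (j 0) * basis_vec 0 (j 1) * basis_vec 1 (j 2) +
      basis_vec 1 (j 0) * basis_vec 1 (j 1) * basis_vec 0 (j 2)) * mode_tail k d j" for j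
  define D where "D j = basis_vec 1 (j 0) * basis_vec 1 (j 1) * basis_vec 1 (j 2) * mode_tail k d j" for j
  have space: "C \<in> tensor_space k d" "D \<in> tensor_space k d"
    by (auto simp: C_def D_def mode_tail_def tensor_space_def)
  have tri: "\<And>X Y. X \<in> tensor_space k d \<Longrightarrow> Y \<in> tensor_space k d \<Longrightarrow> N (\<lambda>j. X j + Y j) \<le> N X + N Y"
    and hom: "\<And>X c. X \<in> tensor_space k d \<Longrightarrow> N (\<lambda>j. c * X j) = \<bar>c\<bar> * N X"
    and nonneg: "\<And>X. X \<in> tensor_space k d \<Longrightarrow> 0 \<le> N X"
    using N by (auto simp: tensor_norm_def)
  have nn: "0 \<le> N C" "0 \<le> N D" using nonneg space by auto
  \<comment> \<open>The bound by 1 gives \<open>h\<^sup>2 \<le> h\<close>; the summand 1 keeps the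
    denominator positive and makes the final estimate strict.\<close>
  define h where "h = min 1 (e / (N C + N D + 1))"
  have h: "h > 0" "h \<le> 1" using \<open>e > 0\<close> nn by (auto simp: h_def)
  have "core_tensor k d m j - core_approx k d m h j = (- h) * C j + (- h\<^sup>2) * D j" for j
    unfolding core_tensor_eq_sum[OF \<open>k \<ge> 3\<close>] core_approx_def outer3_apply[OF \<open>k \<ge> 3\<close>] C_def D_def
    using h by (simp add: field_simps power2_eq_square)
  then have "N (\<lambda>j. core_tensor k d m j - core_approx k d m h j) = N (\<lambda>j. (- h) * C j + (- h\<^sup>2) * D j)"
    by simp
  also have "\<dots> \<le> N (\<lambda>j. (- h) * C j) + N (\<lambda>j. (- h\<^sup>2) * D j)"
    using space by (intro tri) (auto simp: tensor_space_def)
  also have "\<dots> = h * N C + h\<^sup>2 * N D"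
    unfolding hom[OF space(1)] hom[OF space(2)] using h by simp
  also have "\<dots> \<le> h * N C + h * N D"
    using h nn by (intro add_mono mult_right_mono) (auto simp: power2_eq_square mult_le_one)
  also have "\<dots> < h * (N C + N D + 1)" using h by (simp add: algebra_simps)
  also have "\<dots> \<le> e / (N C + N D + 1) * (N C + N D + 1)"
    using nn by (intro mult_right_mono) (auto simp: h_def)
  also have "\<dots> = e" using nn by simp
  finally show ?thesis using core_approx_rank_le by blast
qed

theorem theorem4p10:
  fixes k r :: nat and d :: "nat \<Rightarrow> nat"
  assumes "k \<ge> 3"
    and "\<forall>i<k. d i \<ge> 2"
    and "2 \<le> r" and "r \<le> Min (d ` {..<k})"
  shows "(\<forall>N. tensor_norm k d N \<longrightarrow>
            \<not> (\<forall>A\<in>tensor_space k d. \<exists>B. best_rank_approximation k d N r A B)) \<and>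
         (\<exists>A\<in>tensor_space k d. tensor_rank k d A = r + 1 \<and>
            (\<forall>N. tensor_norm k d N \<longrightarrow> \<not> (\<exists>B. best_rank_approximation k d N r A B)))"
proof -
  \<comment> \<open>Here \<open>m\<close> counts the diagonal terms: the three terms of W bring the
    total to \<open>r + 1\<close>, the two terms approximating W only to \<open>r\<close>.\<close>
  obtain m where r: "r = m + 2"
    using \<open>2 \<le> r\<close> by (metis le_add_diff_inverse2)
  define A where "A = core_tensor k d m"
  have "k \<ge> 1" using \<open>k \<ge> 3\<close> by simp
  have d: "m + 2 \<le> d i" if "i < k" for i
    using assms(4) that r by (subst (asm) Min_ge_iff) auto
  have sod: "sum_of_decomposables k d (Suc r) A"
    using sum_of_decomposables_core_tensor[OF \<open>k \<ge> 3\<close>, of d m] by (simp add: A_def r numeral_3_eq_3)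
  have A: "A \<in> tensor_space k d"
    using sod by (rule sum_of_decomposables_in_tensor_space)
  have "\<not> sum_of_decomposables k d r A"
    unfolding A_def r using \<open>k \<ge> 3\<close> d by (rule core_tensor_not_sum_of_decomposables)
  with \<open>k \<ge> 1\<close> sod have rank: "tensor_rank k d A = r + 1"
    using tensor_rank_eq_SucI by simp
  have no_best: "\<not> best_rank_approximation k d N r A B" if "tensor_norm k d N" for N B
    using core_tensor_approximable[OF \<open>k \<ge> 3\<close> that] rank
    by (intro not_best_rank_approximation[OF that A]) (auto simp: A_def r)
  \<comment> \<open>\<open>A\<close> was fixed before the norm, so it witnesses both
    conjuncts.\<close>
  show ?thesis using A rank no_best by blast
qed

end
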